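(* Let $H$ be a finite Heyting algebra and let $M$ be a distributive module over $H$. Then there is a canonical map $(\cdot\to\cdot)_M:M\times M\to H$ making $M$ a Heyting module over $H$, i.e. such that for all $m,n\in M$ and $x\in H$ one has $x\wedge m\le n$ if and only if $x\le (m\to n)_M$.
   Context: Lattices have all finite meets and joins (hence a least element $0$ and a greatest element $1$). A join semilattice is a poset in which every finite subset, including the empty one, has a join; its least element is $0$. For a distributive lattice $L$, a distributive module over $L$ is a join semilattice $M$ with an action $L\times M\to M$, $(x,m)\mapsto x\wedge m$, order preserving in both variables, such that $1\wedge m=m$, $0\wedge m=0$, $(x\wedge y)\wedge m=x\wedge(y\wedge m)$, $(x\vee y)\wedge m=(x\wedge m)\vee(y\wedge m)$, $x\wedge(m\vee n)=(x\wedge m)\vee(x\wedge n)$. A Heyting algebra $H$ is a lattice such that for all $y,z\in H$ there is $(y\to z)_H\in H$ with $x\wedge y\le z\Leftrightarrow x\le (y\to z)_H$ for all $x\in H$; every Heyting algebra is distributive. A Heyting module over $H$ is a distributive module $M$ over the distributive lattice underlying $H$ such that for each $m\in M$ the functor (order preserving map) $H\to M$, $x\mapsto x\wedge m$, has a right adjoint, i.e. for all $m,n\in M$ there is $(m\to n)_M\in H$ with $x\wedge m\le n\Leftrightarrow x\le(m\to n)_M$ for all $x\in H$. *)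

theory Defs
  imports Main
begin

class heyting_algebra = bounded_lattice +
  assumes ex_implication: "\<exists>r. \<forall>x. inf x y \<le> z \<longleftrightarrow> x \<le> r"
begin

subclass distrib_lattice
proof
  fix x y z
  have "inf x (sup y z) \<le> sup (inf x y) (inf x z)" for x y z
    using ex_implication[of x "sup (inf x y) (inf x z)"]
    by (metis inf_commute le_supI sup_ge1 sup_ge2)
  then show "sup x (inf y z) = inf (sup x y) (sup x z)"
    by (intro distrib_imp1 order.antisym le_supI) (auto intro: le_infI2)
qed

end

text \<open>
  The classes \<open>bounded_lattice\<close> and \<open>bounded_semilattice_sup_bot\<close> express the existence of
  finite meets and joins by the binary operations together with \<open>top\<close> and \<open>bot\<close>. The action
  \<open>act x m\<close> is the element written $x \wedge m$ for $x \in L$, $m \in M$.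
\<close>

locale distributive_module =
  fixes act :: "'l::{bounded_lattice, distrib_lattice} \<Rightarrow> 'm::bounded_semilattice_sup_bot \<Rightarrow> 'm"
  assumes act_mono_left: "x \<le> y \<Longrightarrow> act x m \<le> act y m"
    and act_mono_right: "m \<le> n \<Longrightarrow> act x m \<le> act x n"
    and act_top: "act top m = m"
    and act_bot: "act bot m = bot"
    and act_inf: "act (inf x y) m = act x (act y m)"
    and act_sup_left: "act (sup x y) m = sup (act x m) (act y m)"
    and act_sup_right: "act x (sup m n) = sup (act x m) (act x n)"

locale heyting_module = distributive_module act
  for act :: "'h::heyting_algebra \<Rightarrow> 'm::bounded_semilattice_sup_bot \<Rightarrow> 'm" +
  assumes ex_right_adjoint: "\<exists>r. \<forall>x. act x m \<le> n \<longleftrightarrow> x \<le> r"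

end

theory Submission
  imports Defs
begin

text \<open>For fixed \<open>m\<close> and \<open>n\<close>, the \<open>x\<close> with
  \<open>act x m \<le> n\<close> form an ideal: a down-set by monotonicity, containing
  \<open>bot\<close> and closed under \<open>sup\<close> by the module axioms. In a finite lattice
  every ideal is principal (\<open>finite_sup_closed_has_greatest\<close>), and its generator is the
  value of the implication at \<open>m\<close> and \<open>n\<close>
  (\<open>ex_right_adjoint_if_finite\<close>).\<close>

lemma finite_sup_closed_has_greatest:
  fixes A :: "'a::semilattice_sup set"
  assumes "finite A" and "A \<noteq> {}" and sup_closed: "\<And>x y. x \<in> A \<Longrightarrow> y \<in> A \<Longrightarrow> sup x y \<in> A"
  obtains r where "r \<in> A" and "\<And>x. x \<in> A \<Longrightarrow> x \<le> r"
proof -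
  obtain r where r: "r \<in> A" and maximal: "\<And>x. x \<in> A \<Longrightarrow> r \<le> x \<Longrightarrow> r = x"
    using finite_has_maximal[OF assms(1,2)] by blast
  \<comment> \<open>Maximal becomes greatest: \<open>sup x r\<close> lies in \<open>A\<close> above
    \<open>r\<close>, so it equals \<open>r\<close>.\<close>
  have "x \<le> r" if "x \<in> A" for x
    using maximal[OF sup_closed[OF that r] sup_ge2] sup_ge1[of x r] by simp
  with r that show thesis by blast
qed

text \<open>Finiteness is a premise on \<open>UNIV\<close> because the locale fixes the sort of
  \<open>'l\<close>, which does not include \<open>finite\<close>.\<close>

lemma (in distributive_module) ex_right_adjoint_if_finite:
  assumes "finite (UNIV :: 'l set)"
  shows "\<exists>r :: 'l. \<forall>x. act x m \<le> n \<longleftrightarrow> x \<le> r"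
proof -
  let ?A = "{x. act x m \<le> n}"
  have "finite ?A"
    using assms by (rule rev_finite_subset) simp
  moreover have "bot \<in> ?A"
    by (simp add: act_bot)
  then have "?A \<noteq> {}" by blast
  moreover have "sup x y \<in> ?A" if "x \<in> ?A" "y \<in> ?A" for x y
    using that by (simp add: act_sup_left)
  ultimately obtain r where "r \<in> ?A" and "\<And>x. x \<in> ?A \<Longrightarrow> x \<le> r"
    using finite_sup_closed_has_greatest by blast
  \<comment> \<open>Being greatest gives one direction; for the other, \<open>x \<le> r\<close>
    yields \<open>act x m \<le> act r m \<le> n\<close>.\<close>
  then show ?thesis
    using act_mono_left order_trans by blast
qed

theorem proposition3p6:
  fixes act :: "'h::{finite, heyting_algebra} \<Rightarrow> 'm::bounded_semilattice_sup_bot \<Rightarrow> 'm"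
  assumes "distributive_module act"
  shows "heyting_module act \<and>
    (\<exists>!imp :: 'm \<Rightarrow> 'm \<Rightarrow> 'h. \<forall>m n x. act x m \<le> n \<longleftrightarrow> x \<le> imp m n)"
proof
  interpret distributive_module act by fact
  have adjoint: "\<exists>r. \<forall>x. act x m \<le> n \<longleftrightarrow> x \<le> r" for m n
    by (rule ex_right_adjoint_if_finite) (rule finite)
  then show "heyting_module act"
    by unfold_locales
  from adjoint obtain imp where imp: "\<And>m n x. act x m \<le> n \<longleftrightarrow> x \<le> imp m n"
    by metis
  show "\<exists>!imp :: 'm \<Rightarrow> 'm \<Rightarrow> 'h. \<forall>m n x. act x m \<le> n \<longleftrightarrow> x \<le> imp m n"
  proof (rule ex1I)
    show "\<forall>m n x. act x m \<le> n \<longleftrightarrow> x \<le> imp m n"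
      using imp by blast
  next
    fix imp' :: "'m \<Rightarrow> 'm \<Rightarrow> 'h"
    assume "\<forall>m n x. act x m \<le> n \<longleftrightarrow> x \<le> imp' m n"
    \<comment> \<open>Both values have the same lower bounds \<open>x\<close>; taking
      \<open>x\<close> to be each value in turn gives the two inequalities.\<close>
    then show "imp' = imp"
      using imp by (intro ext order.antisym) blast+
  qed
qed

end
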